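(* Let $\mathcal{C}$ be a Markov category with conditionals and let $p$ be a hidden Markov model in $\mathcal{C}$ with transition kernels $f_t\colon X_{t-1}\to X_t$ and observation kernels $g_t\colon X_t\to Y_t$, $t=0,\dots,n$ (with $X_{-1}=I$). Put $\mathrm{BF}_{-1}:=\mathrm{id}_I$. Then for every $t=0,\dots,n$ the Bayes filter satisfies $$\mathrm{BF}_t\;=_{p^Y_{[t]}\text{-a.s.}}\;(r_t)_{|Y_t},\qquad r_t:=(\mathrm{id}_{X_t}\otimes g_t)\circ\mathrm{copy}_{X_t}\circ f_t\circ\mathrm{BF}_{t-1}\;\colon\;Y_{[t-1]}\to X_t\otimes Y_t,$$ where $(r_t)_{|Y_t}\colon Y_{[t-1]}\otimes Y_t=Y_{[t]}\to X_t$ is a conditional of $r_t$ with respect to $Y_t$ (for any choice of Bayes filters and of conditional).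
   Context: A Markov category is a symmetric monoidal category whose monoidal unit $I$ is terminal, in which every object $X$ carries a distinguished commutative comonoid structure $\mathrm{copy}_X\colon X\to X\otimes X$, $\mathrm{del}_X\colon X\to I$, compatible with $\otimes$. Coherence isomorphisms and symmetries (reorderings of tensor factors) are suppressed. Marginals are obtained by composing with $\mathrm{del}$ on some outputs. Conditionals: a conditional of $f\colon A\to X\otimes Y$ with respect to $Y$ is a morphism $f_{|Y}\colon A\otimes Y\to X$ such that $f$ equals the composite: copy $A$; apply to one copy the marginal $f_Y:=(\mathrm{del}_X\otimes\mathrm{id}_Y)\circ f$; copy the resulting $Y$; output one copy of $Y$ and apply $f_{|Y}$ to the other copy of $A$ and the other copy of $Y$ to produce $X$. $\mathcal{C}$ has conditionals if these always exist. Almost sure equality: for $q\colon W\to A$ and $a,b\colon A\to X$, $a=_{q\text{-a.s.}}b$ means $(\mathrm{id}_A\otimes a)\circ\mathrm{copy}_A\circ q=(\mathrm{id}_A\otimes b)\circ\mathrm{copy}_A\circ q$. Notation: $[t]=\{0,\dots,t\}$, $[-1]=\emptyset$; $Y_{[t]}=Y_0\otimes\cdots\otimes Y_t$, $Y_{[-1]}=I$. Hidden Markov model: given $f_t\colon X_{t-1}\to X_t$ and $g_t\colon X_t\to Y_t$ ($t=0,\dots,n$, $X_{-1}:=I$), it is the state $p\colon I\to\bigotimes_{t\in[n]}(X_t\otimes Y_t)$, $p=\big(\bigotimes_{t=0}^n((\mathrm{id}_{X_t}\otimes g_t)\circ\mathrm{copy}_{X_t})\big)\circ m_n$, where $m_0=f_0$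 and $m_t=\big(\mathrm{id}_{X_0\otimes\cdots\otimes X_{t-2}}\otimes((\mathrm{id}_{X_{t-1}}\otimes f_t)\circ\mathrm{copy}_{X_{t-1}})\big)\circ m_{t-1}$. Write $p^Y_{[t]}$ for the marginal of $p$ on $Y_{[t]}$. Bayes filter: $\mathrm{BF}_t\colon Y_{[t]}\to X_t$ is a conditional, with respect to $Y_{[t]}$, of the marginal of $p$ on $Y_{[t]}\otimes X_t$; i.e. this marginal equals $(\mathrm{id}_{Y_{[t]}}\otimes\mathrm{BF}_t)\circ\mathrm{copy}_{Y_{[t]}}\circ p^Y_{[t]}$. It is unique up to $p^Y_{[t]}$-almost sure equality. *)

theory Defs
  imports Main
begin

section \<open>Symmetric monoidal categories\<close>

record ('o, 'm) category_data =
  Ob   :: "'o set"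
  Ar   :: "'m set"
  Dom  :: "'m \<Rightarrow> 'o"
  Cod  :: "'m \<Rightarrow> 'o"
  Id   :: "'o \<Rightarrow> 'm"          ("\<one>\<index>")
  Comp :: "'m \<Rightarrow> 'm \<Rightarrow> 'm"    (infixr "\<cdot>\<index>" 55)

record ('o, 'm) smc_data = "('o, 'm) category_data" +
  Unit   :: "'o"                          ("\<I>\<index>")
  TensOb :: "'o \<Rightarrow> 'o \<Rightarrow> 'o"               (infixl "\<odot>\<index>" 70)
  TensAr :: "'m \<Rightarrow> 'm \<Rightarrow> 'm"               (infixl "\<otimes>\<index>" 70)
  Assoc  :: "'o \<Rightarrow> 'o \<Rightarrow> 'o \<Rightarrow> 'm"          ("\<alpha>\<index>")
  LUnit  :: "'o \<Rightarrow> 'm"                     ("\<ell>\<index>")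
  RUnit  :: "'o \<Rightarrow> 'm"                     ("\<rho>\<index>")
  Sym    :: "'o \<Rightarrow> 'o \<Rightarrow> 'm"               ("\<sigma>\<index>")

definition hom :: "('o, 'm, 'x) category_data_scheme \<Rightarrow> 'o \<Rightarrow> 'o \<Rightarrow> 'm set" where
  "hom C A B = {f \<in> Ar C. Dom C f = A \<and> Cod C f = B}"

definition inverse_pair :: "('o, 'm, 'x) category_data_scheme \<Rightarrow> 'o \<Rightarrow> 'o \<Rightarrow> 'm \<Rightarrow> 'm \<Rightarrow> bool" where
  "inverse_pair C A B f h \<longleftrightarrow>
     f \<in> hom C A B \<and> h \<in> hom C B A \<and> h \<cdot>\<^bsub>C\<^esub> f = \<one>\<^bsub>C\<^esub> A \<and> f \<cdot>\<^bsub>C\<^esub> h = \<one>\<^bsub>C\<^esub> B"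

definition is_iso :: "('o, 'm, 'x) category_data_scheme \<Rightarrow> 'o \<Rightarrow> 'o \<Rightarrow> 'm \<Rightarrow> bool" where
  "is_iso C A B f \<longleftrightarrow> (\<exists>h. inverse_pair C A B f h)"

definition inv_ar :: "('o, 'm, 'x) category_data_scheme \<Rightarrow> 'm \<Rightarrow> 'm" where
  "inv_ar C f = (THE h. inverse_pair C (Dom C f) (Cod C f) f h)"

locale category =
  fixes C :: "('o, 'm, 'x) category_data_scheme" (structure)
  assumes Dom_Ob: "f \<in> Ar C \<Longrightarrow> Dom C f \<in> Ob C"
    and Cod_Ob: "f \<in> Ar C \<Longrightarrow> Cod C f \<in> Ob C"
    and Id_hom: "A \<in> Ob C \<Longrightarrow> \<one> A \<in> hom C A A"
    and Comp_hom: "\<lbrakk>f \<in> hom C A B; h \<in> hom C B D\<rbrakk> \<Longrightarrow> h \<cdot> f \<in> hom C A D"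
    and Id_left: "f \<in> hom C A B \<Longrightarrow> \<one> B \<cdot> f = f"
    and Id_right: "f \<in> hom C A B \<Longrightarrow> f \<cdot> \<one> A = f"
    and Comp_assoc: "\<lbrakk>f \<in> hom C A B; h \<in> hom C B D; k \<in> hom C D E\<rbrakk> \<Longrightarrow> (k \<cdot> h) \<cdot> f = k \<cdot> (h \<cdot> f)"

locale symmetric_monoidal_category = category C
  for C :: "('o, 'm, 'x) smc_data_scheme" (structure) +
  assumes Unit_Ob: "\<I> \<in> Ob C"
    and TensOb_Ob: "\<lbrakk>A \<in> Ob C; B \<in> Ob C\<rbrakk> \<Longrightarrow> A \<odot> B \<in> Ob C"
    and TensAr_hom: "\<lbrakk>f \<in> hom C A B; h \<in> hom C A' B'\<rbrakk> \<Longrightarrow> f \<otimes> h \<in> hom C (A \<odot> A') (B \<odot> B')"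
    and TensAr_Id: "\<lbrakk>A \<in> Ob C; B \<in> Ob C\<rbrakk> \<Longrightarrow> \<one> A \<otimes> \<one> B = \<one> (A \<odot> B)"
    and TensAr_Comp: "\<lbrakk>f \<in> hom C A B; h \<in> hom C B D; f' \<in> hom C A' B'; h' \<in> hom C B' D'\<rbrakk>
          \<Longrightarrow> (h \<cdot> f) \<otimes> (h' \<cdot> f') = (h \<otimes> h') \<cdot> (f \<otimes> f')"
    and Assoc_iso: "\<lbrakk>A \<in> Ob C; B \<in> Ob C; D \<in> Ob C\<rbrakk>
          \<Longrightarrow> is_iso C ((A \<odot> B) \<odot> D) (A \<odot> (B \<odot> D)) (\<alpha> A B D)"
    and Assoc_nat: "\<lbrakk>f \<in> hom C A A'; h \<in> hom C B B'; k \<in> hom C D D'\<rbrakk>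
          \<Longrightarrow> \<alpha> A' B' D' \<cdot> ((f \<otimes> h) \<otimes> k) = (f \<otimes> (h \<otimes> k)) \<cdot> \<alpha> A B D"
    and LUnit_iso: "A \<in> Ob C \<Longrightarrow> is_iso C (\<I> \<odot> A) A (\<ell> A)"
    and LUnit_nat: "f \<in> hom C A B \<Longrightarrow> \<ell> B \<cdot> (\<one> \<I> \<otimes> f) = f \<cdot> \<ell> A"
    and RUnit_iso: "A \<in> Ob C \<Longrightarrow> is_iso C (A \<odot> \<I>) A (\<rho> A)"
    and RUnit_nat: "f \<in> hom C A B \<Longrightarrow> \<rho> B \<cdot> (f \<otimes> \<one> \<I>) = f \<cdot> \<rho> A"
    and Sym_hom: "\<lbrakk>A \<in> Ob C; B \<in> Ob C\<rbrakk> \<Longrightarrow> \<sigma> A B \<in> hom C (A \<odot> B) (B \<odot> A)"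
    and Sym_nat: "\<lbrakk>f \<in> hom C A A'; h \<in> hom C B B'\<rbrakk> \<Longrightarrow> \<sigma> A' B' \<cdot> (f \<otimes> h) = (h \<otimes> f) \<cdot> \<sigma> A B"
    and Sym_Sym: "\<lbrakk>A \<in> Ob C; B \<in> Ob C\<rbrakk> \<Longrightarrow> \<sigma> B A \<cdot> \<sigma> A B = \<one> (A \<odot> B)"
    and triangle: "\<lbrakk>A \<in> Ob C; B \<in> Ob C\<rbrakk> \<Longrightarrow> (\<one> A \<otimes> \<ell> B) \<cdot> \<alpha> A \<I> B = \<rho> A \<otimes> \<one> B"
    and pentagon: "\<lbrakk>A \<in> Ob C; B \<in> Ob C; D \<in> Ob C; E \<in> Ob C\<rbrakk>
          \<Longrightarrow> \<alpha> A B (D \<odot> E) \<cdot> \<alpha> (A \<odot> B) D E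
              = (\<one> A \<otimes> \<alpha> B D E) \<cdot> \<alpha> A (B \<odot> D) E \<cdot> (\<alpha> A B D \<otimes> \<one> E)"
    and hexagon: "\<lbrakk>A \<in> Ob C; B \<in> Ob C; D \<in> Ob C\<rbrakk>
          \<Longrightarrow> \<alpha> B D A \<cdot> \<sigma> A (B \<odot> D) \<cdot> \<alpha> A B D
              = (\<one> B \<otimes> \<sigma> A D) \<cdot> \<alpha> B A D \<cdot> (\<sigma> A B \<otimes> \<one> D)"

section \<open>Markov categories\<close>

record ('o, 'm) markov_data = "('o, 'm) smc_data" +
  Copy :: "'o \<Rightarrow> 'm"    ("\<Delta>\<index>")
  Del  :: "'o \<Rightarrow> 'm"    ("\<epsilon>\<index>")

definition middle_swap :: "('o, 'm, 'x) smc_data_scheme \<Rightarrow> 'o \<Rightarrow> 'o \<Rightarrow> 'o \<Rightarrow> 'o \<Rightarrow> 'm" where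
  \<comment> \<open>the canonical morphism from \<open>(A \<odot> B) \<odot> (D \<odot> E)\<close> to \<open>(A \<odot> D) \<odot> (B \<odot> E)\<close>\<close>
  "middle_swap C A B D E =
     inv_ar C (\<alpha>\<^bsub>C\<^esub> A D (B \<odot>\<^bsub>C\<^esub> E))
     \<cdot>\<^bsub>C\<^esub> (\<one>\<^bsub>C\<^esub> A \<otimes>\<^bsub>C\<^esub>
           (\<alpha>\<^bsub>C\<^esub> D B E \<cdot>\<^bsub>C\<^esub> (\<sigma>\<^bsub>C\<^esub> B D \<otimes>\<^bsub>C\<^esub> \<one>\<^bsub>C\<^esub> E) \<cdot>\<^bsub>C\<^esub> inv_ar C (\<alpha>\<^bsub>C\<^esub> B D E)))
     \<cdot>\<^bsub>C\<^esub> \<alpha>\<^bsub>C\<^esub> A B (D \<odot>\<^bsub>C\<^esub> E)"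

locale markov_category = symmetric_monoidal_category C
  for C :: "('o, 'm, 'x) markov_data_scheme" (structure) +
  assumes Unit_terminal: "A \<in> Ob C \<Longrightarrow> \<exists>!f. f \<in> hom C A \<I>"
    and Copy_hom: "A \<in> Ob C \<Longrightarrow> \<Delta> A \<in> hom C A (A \<odot> A)"
    and Del_hom: "A \<in> Ob C \<Longrightarrow> \<epsilon> A \<in> hom C A \<I>"
    and Copy_coassoc: "A \<in> Ob C \<Longrightarrow> \<alpha> A A A \<cdot> (\<Delta> A \<otimes> \<one> A) \<cdot> \<Delta> A = (\<one> A \<otimes> \<Delta> A) \<cdot> \<Delta> A"
    and Copy_counit_left: "A \<in> Ob C \<Longrightarrow> \<ell> A \<cdot> (\<epsilon> A \<otimes> \<one> A) \<cdot> \<Delta> A = \<one> A"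
    and Copy_counit_right: "A \<in> Ob C \<Longrightarrow> \<rho> A \<cdot> (\<one> A \<otimes> \<epsilon> A) \<cdot> \<Delta> A = \<one> A"
    and Copy_commute: "A \<in> Ob C \<Longrightarrow> \<sigma> A A \<cdot> \<Delta> A = \<Delta> A"
    and Copy_tensor: "\<lbrakk>A \<in> Ob C; B \<in> Ob C\<rbrakk>
          \<Longrightarrow> \<Delta> (A \<odot> B) = middle_swap C A A B B \<cdot> (\<Delta> A \<otimes> \<Delta> B)"
    and Del_tensor: "\<lbrakk>A \<in> Ob C; B \<in> Ob C\<rbrakk> \<Longrightarrow> \<epsilon> (A \<odot> B) = \<ell> \<I> \<cdot> (\<epsilon> A \<otimes> \<epsilon> B)"
    and Copy_Unit: "\<Delta> \<I> = inv_ar C (\<ell> \<I>)"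
    and Del_Unit: "\<epsilon> \<I> = \<one> \<I>"

definition marg_left :: "('o, 'm, 'x) markov_data_scheme \<Rightarrow> 'o \<Rightarrow> 'o \<Rightarrow> 'm" where
  "marg_left C X Y = \<rho>\<^bsub>C\<^esub> X \<cdot>\<^bsub>C\<^esub> (\<one>\<^bsub>C\<^esub> X \<otimes>\<^bsub>C\<^esub> \<epsilon>\<^bsub>C\<^esub> Y)"

definition marg_right :: "('o, 'm, 'x) markov_data_scheme \<Rightarrow> 'o \<Rightarrow> 'o \<Rightarrow> 'm" where
  "marg_right C X Y = \<ell>\<^bsub>C\<^esub> Y \<cdot>\<^bsub>C\<^esub> (\<epsilon>\<^bsub>C\<^esub> X \<otimes>\<^bsub>C\<^esub> \<one>\<^bsub>C\<^esub> Y)"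

definition is_conditional ::
  "('o, 'm, 'x) markov_data_scheme \<Rightarrow> 'o \<Rightarrow> 'o \<Rightarrow> 'o \<Rightarrow> 'm \<Rightarrow> 'm \<Rightarrow> bool" where
  \<comment> \<open>\<open>c\<close> is a conditional of \<open>f : A \<rightarrow> X \<odot> Y\<close> with respect to \<open>Y\<close>\<close>
  "is_conditional C A X Y f c \<longleftrightarrow>
     c \<in> hom C (A \<odot>\<^bsub>C\<^esub> Y) X \<and>
     f = (c \<otimes>\<^bsub>C\<^esub> \<one>\<^bsub>C\<^esub> Y)
         \<cdot>\<^bsub>C\<^esub> inv_ar C (\<alpha>\<^bsub>C\<^esub> A Y Y)
         \<cdot>\<^bsub>C\<^esub> (\<one>\<^bsub>C\<^esub> A \<otimes>\<^bsub>C\<^esub> (\<Delta>\<^bsub>C\<^esub> Y \<cdot>\<^bsub>C\<^esub> marg_right C X Y \<cdot>\<^bsub>C\<^esub> f))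
         \<cdot>\<^bsub>C\<^esub> \<Delta>\<^bsub>C\<^esub> A"

definition has_conditionals :: "('o, 'm, 'x) markov_data_scheme \<Rightarrow> bool" where
  "has_conditionals C \<longleftrightarrow>
     (\<forall>A\<in>Ob C. \<forall>X\<in>Ob C. \<forall>Y\<in>Ob C. \<forall>f\<in>hom C A (X \<odot>\<^bsub>C\<^esub> Y). \<exists>c. is_conditional C A X Y f c)"

definition as_equal :: "('o, 'm, 'x) markov_data_scheme \<Rightarrow> 'm \<Rightarrow> 'm \<Rightarrow> 'm \<Rightarrow> bool" where
  "as_equal C q a b \<longleftrightarrow>
     (let A = Cod C q in
       (\<one>\<^bsub>C\<^esub> A \<otimes>\<^bsub>C\<^esub> a) \<cdot>\<^bsub>C\<^esub> \<Delta>\<^bsub>C\<^esub> A \<cdot>\<^bsub>C\<^esub> q = (\<one>\<^bsub>C\<^esub> A \<otimes>\<^bsub>C\<^esub> b) \<cdot>\<^bsub>C\<^esub> \<Delta>\<^bsub>C\<^esub> A \<cdot>\<^bsub>C\<^esub> q)"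

section \<open>Hidden Markov models and Bayes filters\<close>

text \<open>
  \<open>tens_ob C A k\<close> is the tensor product of the \<open>k\<close> factors \<open>A 0, \<dots>, A (k - 1)\<close>, bracketed to the
  left and starting from the monoidal unit.  Thus \<open>tens_ob C Y (Suc t)\<close> is the product of
  the objects with indices in \<open>{0, \<dots>, t}\<close>, and \<open>tens_ob C Y 0 = \<I>\<close> is the case \<open>t = -1\<close>.
\<close>

primrec tens_ob :: "('o, 'm, 'x) smc_data_scheme \<Rightarrow> (nat \<Rightarrow> 'o) \<Rightarrow> nat \<Rightarrow> 'o" where
  "tens_ob C A 0 = \<I>\<^bsub>C\<^esub>"
| "tens_ob C A (Suc k) = tens_ob C A k \<odot>\<^bsub>C\<^esub> A k"

primrec tens_ar :: "('o, 'm, 'x) smc_data_scheme \<Rightarrow> (nat \<Rightarrow> 'm) \<Rightarrow> nat \<Rightarrow> 'm" where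
  "tens_ar C h 0 = \<one>\<^bsub>C\<^esub> \<I>\<^bsub>C\<^esub>"
| "tens_ar C h (Suc k) = tens_ar C h k \<otimes>\<^bsub>C\<^esub> h k"

primrec del_tail :: "('o, 'm, 'x) markov_data_scheme \<Rightarrow> (nat \<Rightarrow> 'o) \<Rightarrow> nat \<Rightarrow> nat \<Rightarrow> 'm" where
  \<comment> \<open>for \<open>j \<le> k\<close>, the morphism from \<open>tens_ob C A k\<close> to \<open>tens_ob C A j\<close> deleting the factors from \<open>A j\<close> on\<close>
  "del_tail C A j 0 = \<one>\<^bsub>C\<^esub> \<I>\<^bsub>C\<^esub>"
| "del_tail C A j (Suc k) =
     (if j \<le> k then del_tail C A j k \<cdot>\<^bsub>C\<^esub> marg_left C (tens_ob C A k) (A k)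
      else \<one>\<^bsub>C\<^esub> (tens_ob C A (Suc k)))"

definition pred_ob :: "('o, 'm, 'x) smc_data_scheme \<Rightarrow> (nat \<Rightarrow> 'o) \<Rightarrow> nat \<Rightarrow> 'o" where
  \<comment> \<open>\<open>X\<close> at index \<open>t - 1\<close>, with \<open>\<I>\<close> at index \<open>-1\<close>\<close>
  "pred_ob C X t = (case t of 0 \<Rightarrow> \<I>\<^bsub>C\<^esub> | Suc s \<Rightarrow> X s)"

definition pred_filter :: "('o, 'm, 'x) smc_data_scheme \<Rightarrow> (nat \<Rightarrow> 'm) \<Rightarrow> nat \<Rightarrow> 'm" where
  \<comment> \<open>\<open>BF\<close> at index \<open>t - 1\<close>, with the identity of \<open>\<I>\<close> at index \<open>-1\<close>\<close>
  "pred_filter C BF t = (case t of 0 \<Rightarrow> \<one>\<^bsub>C\<^esub> \<I>\<^bsub>C\<^esub> | Suc s \<Rightarrow> BF s)"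

definition hmm_kernels ::
  "('o, 'm, 'x) markov_data_scheme \<Rightarrow> nat \<Rightarrow> (nat \<Rightarrow> 'o) \<Rightarrow> (nat \<Rightarrow> 'o) \<Rightarrow> (nat \<Rightarrow> 'm) \<Rightarrow> (nat \<Rightarrow> 'm) \<Rightarrow> bool"
  where
  "hmm_kernels C n X Y f g \<longleftrightarrow>
     (\<forall>t\<le>n. X t \<in> Ob C \<and> Y t \<in> Ob C \<and> f t \<in> hom C (pred_ob C X t) (X t) \<and> g t \<in> hom C (X t) (Y t))"

text \<open>In the base case the codomain \<open>X 0\<close> of \<open>f 0\<close> is identified with \<open>tens_ob C X 1 = \<I> \<odot> X 0\<close>.\<close>

primrec hidden_chain ::
  "('o, 'm, 'x) markov_data_scheme \<Rightarrow> (nat \<Rightarrow> 'o) \<Rightarrow> (nat \<Rightarrow> 'm) \<Rightarrow> nat \<Rightarrow> 'm" where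
  "hidden_chain C X f 0 = inv_ar C (\<ell>\<^bsub>C\<^esub> (X 0)) \<cdot>\<^bsub>C\<^esub> f 0"
| "hidden_chain C X f (Suc t) =
     inv_ar C (\<alpha>\<^bsub>C\<^esub> (tens_ob C X t) (X t) (X (Suc t)))
     \<cdot>\<^bsub>C\<^esub> (\<one>\<^bsub>C\<^esub> (tens_ob C X t) \<otimes>\<^bsub>C\<^esub> ((\<one>\<^bsub>C\<^esub> (X t) \<otimes>\<^bsub>C\<^esub> f (Suc t)) \<cdot>\<^bsub>C\<^esub> \<Delta>\<^bsub>C\<^esub> (X t)))
     \<cdot>\<^bsub>C\<^esub> hidden_chain C X f t"

definition hmm ::
  "('o, 'm, 'x) markov_data_scheme \<Rightarrow> nat \<Rightarrow> (nat \<Rightarrow> 'o) \<Rightarrow> (nat \<Rightarrow> 'm) \<Rightarrow> (nat \<Rightarrow> 'm) \<Rightarrow> 'm" where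
  "hmm C n X f g =
     tens_ar C (\<lambda>t. (\<one>\<^bsub>C\<^esub> (X t) \<otimes>\<^bsub>C\<^esub> g t) \<cdot>\<^bsub>C\<^esub> \<Delta>\<^bsub>C\<^esub> (X t)) (Suc n) \<cdot>\<^bsub>C\<^esub> hidden_chain C X f n"

definition marg_obs ::
  "('o, 'm, 'x) markov_data_scheme \<Rightarrow> nat \<Rightarrow> (nat \<Rightarrow> 'o) \<Rightarrow> (nat \<Rightarrow> 'o) \<Rightarrow> nat \<Rightarrow> 'm \<Rightarrow> 'm" where
  \<comment> \<open>the marginal of a state \<open>p\<close> of \<open>tens_ob C (\<lambda>s. X s \<odot> Y s) (Suc n)\<close> on \<open>tens_ob C Y (Suc t)\<close>\<close>
  "marg_obs C n X Y t p =
     tens_ar C (\<lambda>s. marg_right C (X s) (Y s)) (Suc t)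
     \<cdot>\<^bsub>C\<^esub> del_tail C (\<lambda>s. X s \<odot>\<^bsub>C\<^esub> Y s) (Suc t) (Suc n) \<cdot>\<^bsub>C\<^esub> p"

definition marg_obs_hidden ::
  "('o, 'm, 'x) markov_data_scheme \<Rightarrow> nat \<Rightarrow> (nat \<Rightarrow> 'o) \<Rightarrow> (nat \<Rightarrow> 'o) \<Rightarrow> nat \<Rightarrow> 'm \<Rightarrow> 'm" where
  \<comment> \<open>the marginal of such a state \<open>p\<close> on \<open>tens_ob C Y (Suc t) \<odot> X t\<close>\<close>
  "marg_obs_hidden C n X Y t p =
     inv_ar C (\<alpha>\<^bsub>C\<^esub> (tens_ob C Y t) (Y t) (X t))
     \<cdot>\<^bsub>C\<^esub> (tens_ar C (\<lambda>s. marg_right C (X s) (Y s)) t \<otimes>\<^bsub>C\<^esub> \<sigma>\<^bsub>C\<^esub> (X t) (Y t))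
     \<cdot>\<^bsub>C\<^esub> del_tail C (\<lambda>s. X s \<odot>\<^bsub>C\<^esub> Y s) (Suc t) (Suc n) \<cdot>\<^bsub>C\<^esub> p"

definition is_bayes_filter ::
  "('o, 'm, 'x) markov_data_scheme \<Rightarrow> nat \<Rightarrow> (nat \<Rightarrow> 'o) \<Rightarrow> (nat \<Rightarrow> 'o) \<Rightarrow> (nat \<Rightarrow> 'm) \<Rightarrow> (nat \<Rightarrow> 'm)
    \<Rightarrow> nat \<Rightarrow> 'm \<Rightarrow> bool" where
  "is_bayes_filter C n X Y f g t b \<longleftrightarrow>
     b \<in> hom C (tens_ob C Y (Suc t)) (X t) \<and>
     marg_obs_hidden C n X Y t (hmm C n X f g)
     = (\<one>\<^bsub>C\<^esub> (tens_ob C Y (Suc t)) \<otimes>\<^bsub>C\<^esub> b)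
       \<cdot>\<^bsub>C\<^esub> \<Delta>\<^bsub>C\<^esub> (tens_ob C Y (Suc t)) \<cdot>\<^bsub>C\<^esub> marg_obs C n X Y t (hmm C n X f g)"

end

theory Submission
  imports Defs
begin

text \<open>
  Let \<open>s\<^sub>t\<close> be the joint state of the observations before time \<open>t\<close> and the hidden state at time \<open>t\<close>,
  and \<open>P\<^sub>t\<close> the state of the observations up to time \<open>t\<close>.  The filter equation at \<open>t - 1\<close>
  followed by \<open>f\<^sub>t\<close> exhibits \<open>s\<^sub>t\<close> as \<open>P\<^bsub>t-1\<^esub>\<close> copied and pushed through \<open>f\<^sub>t \<circ> BF\<^bsub>t-1\<^esub>\<close>, so
  the joint state of all observations up to \<open>t\<close> and the hidden state at \<open>t\<close> is \<open>P\<^bsub>t-1\<^esub>\<close>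
  copied and pushed through \<open>r\<^sub>t\<close>.  Substituting the conditional
  equation for \<open>r\<^sub>t\<close> and using that copying is coassociative, cocommutative and
  compatible with tensor products rewrites this as \<open>P\<^sub>t\<close> copied and pushed through the
  conditional, which is the defining equation of \<open>BF\<^sub>t\<close>.
\<close>

section \<open>Calculating in a symmetric monoidal category\<close>

context category
begin

lemma hom_iff: "f \<in> hom C A B \<longleftrightarrow> f \<in> Ar C \<and> Dom C f = A \<and> Cod C f = B"
  by (auto simp: hom_def)

text \<open>Typing is split into facts about \<open>Ar\<close>, \<open>Dom\<close> and
  \<open>Cod\<close> so that rewriting can compute it; composing through \<open>hom\<close> would
  require guessing the middle object.\<close>

lemma Id_typing [simp]:
  assumes "A \<in> Ob C"
  shows "\<one> A \<in> Ar C" "Dom C (\<one> A) = A" "Cod C (\<one> A) = A"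
  using Id_hom[OF assms] by (auto simp: hom_iff)

lemma Comp_typing [simp]:
  assumes "f \<in> Ar C" "h \<in> Ar C" "Cod C f = Dom C h"
  shows "h \<cdot> f \<in> Ar C" "Dom C (h \<cdot> f) = Dom C f" "Cod C (h \<cdot> f) = Cod C h"
  using Comp_hom[of f "Dom C f" "Dom C h" h "Cod C h"] assms by (auto simp: hom_iff)

lemma Comp_Id [simp]:
  assumes "f \<in> Ar C"
  shows "Cod C f = A \<Longrightarrow> \<one> A \<cdot> f = f" "Dom C f = A \<Longrightarrow> f \<cdot> \<one> A = f"
  using Id_left[of f "Dom C f" "Cod C f"] Id_right[of f "Dom C f" "Cod C f"] assms
  by (auto simp: hom_iff)

text \<open>Right-nested composition is the normal form. Later calculations bracket the factors that
  are about to be rewritten and let \<open>simp\<close> restore the nesting.\<close>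

lemma Comp_Comp [simp]:
  assumes "f \<in> Ar C" "h \<in> Ar C" "k \<in> Ar C" "Cod C f = Dom C h" "Cod C h = Dom C k"
  shows "(k \<cdot> h) \<cdot> f = k \<cdot> (h \<cdot> f)"
  using Comp_assoc[of f "Dom C f" "Dom C h" h "Dom C k" k "Cod C k"] assms
  by (auto simp: hom_iff)

lemma inverse_pair_unique:
  assumes "inverse_pair C A B f h" "inverse_pair C A B f h'"
  shows "h = h'"
proof -
  have "h = h \<cdot> (f \<cdot> h')"
    using assms by (simp add: inverse_pair_def hom_iff)
  also have "\<dots> = (h \<cdot> f) \<cdot> h'"
    using assms by (intro Comp_Comp[symmetric]) (auto simp: inverse_pair_def hom_iff)
  also have "\<dots> = h'"
    using assms unfolding inverse_pair_def hom_iff by (metis Comp_Id(1))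
  finally show ?thesis .
qed

text \<open>\<open>inv_ar\<close> is a definite description, so it is uniqueness of inverses that
  makes it denote one.\<close>

lemma inverse_pair_inv_ar:
  assumes "is_iso C A B f"
  shows "inverse_pair C A B f (inv_ar C f)"
proof -
  obtain h where h: "inverse_pair C A B f h"
    using assms by (auto simp: is_iso_def)
  then have "Dom C f = A" "Cod C f = B"
    by (auto simp: inverse_pair_def hom_iff)
  then show ?thesis
    unfolding inv_ar_def using h inverse_pair_unique by (metis theI')
qed

lemma inv_ar_props:
  assumes "is_iso C A B f"
  shows "f \<in> Ar C" "Dom C f = A" "Cod C f = B"
    and "inv_ar C f \<in> Ar C" "Dom C (inv_ar C f) = B" "Cod C (inv_ar C f) = A"
    and "inv_ar C f \<cdot> f = \<one> A" "f \<cdot> inv_ar C f = \<one> B"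
  using inverse_pair_inv_ar[OF assms] by (auto simp: inverse_pair_def hom_iff)

text \<open>Cancellation in front of a further arrow \<open>k\<close>: in a right-nested composite,
  an arrow and its inverse do not form a subterm of their own.\<close>

lemma inv_ar_Comp:
  assumes "is_iso C A B f" "k \<in> Ar C"
  shows "Cod C k = A \<Longrightarrow> inv_ar C f \<cdot> (f \<cdot> k) = k"
    and "Cod C k = B \<Longrightarrow> f \<cdot> (inv_ar C f \<cdot> k) = k"
  using Comp_Comp[of k f "inv_ar C f"] Comp_Comp[of k "inv_ar C f" f]
    inv_ar_props[OF assms(1)] assms(2) by auto

end

context symmetric_monoidal_category
begin

declare Unit_Ob [simp] TensOb_Ob [simp] TensAr_Id [simp]

lemma TensAr_typing [simp]:
  assumes "f \<in> Ar C" "h \<in> Ar C"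
  shows "f \<otimes> h \<in> Ar C" "Dom C (f \<otimes> h) = Dom C f \<odot> Dom C h" "Cod C (f \<otimes> h) = Cod C f \<odot> Cod C h"
  using TensAr_hom[of f "Dom C f" "Cod C f" h "Dom C h" "Cod C h"] assms
  by (auto simp: hom_iff)

lemma interchange [simp]:
  assumes "f \<in> Ar C" "h \<in> Ar C" "f' \<in> Ar C" "h' \<in> Ar C" "Cod C f = Dom C h" "Cod C f' = Dom C h'"
  shows "(h \<otimes> h') \<cdot> (f \<otimes> f') = (h \<cdot> f) \<otimes> (h' \<cdot> f')"
  using TensAr_Comp[of f "Dom C f" "Dom C h" h "Cod C h" f' "Dom C f'" "Dom C h'" h' "Cod C h'"] assms
  by (auto simp: hom_iff)

text \<open>The extra \<open>k\<close> serves the same purpose as in \<open>inv_ar_Comp\<close>.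
  Together with \<open>interchange\<close>, this merges stacked tensors into a single tensor of
  composites.\<close>

lemma interchange_Comp [simp]:
  assumes "f \<in> Ar C" "h \<in> Ar C" "f' \<in> Ar C" "h' \<in> Ar C" "Cod C f = Dom C h" "Cod C f' = Dom C h'"
    and "k \<in> Ar C" "Cod C k = Dom C f \<odot> Dom C f'"
  shows "(h \<otimes> h') \<cdot> ((f \<otimes> f') \<cdot> k) = ((h \<cdot> f) \<otimes> (h' \<cdot> f')) \<cdot> k"
  using Comp_Comp[of k "f \<otimes> f'" "h \<otimes> h'"] assms by simp

lemmas Assoc_props [simp] = inv_ar_props[OF Assoc_iso] inv_ar_Comp[OF Assoc_iso]
lemmas LUnit_props [simp] = inv_ar_props[OF LUnit_iso] inv_ar_Comp[OF LUnit_iso]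
lemmas RUnit_props [simp] = inv_ar_props[OF RUnit_iso] inv_ar_Comp[OF RUnit_iso]

lemma Sym_typing [simp]:
  assumes "A \<in> Ob C" "B \<in> Ob C"
  shows "\<sigma> A B \<in> Ar C" "Dom C (\<sigma> A B) = A \<odot> B" "Cod C (\<sigma> A B) = B \<odot> A"
  using Sym_hom[OF assms] by (auto simp: hom_iff)

lemma typed_Ob [simp]:
  assumes "f \<in> Ar C"
  shows "Dom C f \<in> Ob C" "Cod C f \<in> Ob C"
  using assms Dom_Ob Cod_Ob by auto

section \<open>Naturality and coherence\<close>

lemma Assoc_natural:
  assumes "f \<in> Ar C" "h \<in> Ar C" "k \<in> Ar C"
  shows "\<alpha> (Cod C f) (Cod C h) (Cod C k) \<cdot> ((f \<otimes> h) \<otimes> k)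
         = (f \<otimes> (h \<otimes> k)) \<cdot> \<alpha> (Dom C f) (Dom C h) (Dom C k)"
  by (rule Assoc_nat) (use assms in \<open>auto simp: hom_iff\<close>)

text \<open>The naturality square of \<alpha>, composed with the inverse associator on either
  side.\<close>

lemma inv_Assoc_natural:
  assumes "f \<in> Ar C" "h \<in> Ar C" "k \<in> Ar C"
  shows "inv_ar C (\<alpha> (Cod C f) (Cod C h) (Cod C k)) \<cdot> (f \<otimes> (h \<otimes> k))
         = ((f \<otimes> h) \<otimes> k) \<cdot> inv_ar C (\<alpha> (Dom C f) (Dom C h) (Dom C k))"
    (is "?i' \<cdot> ?F' = ?F \<cdot> ?i")
proof -
  have "?i' \<cdot> ?F' = ?i' \<cdot> ((?F' \<cdot> \<alpha> (Dom C f) (Dom C h) (Dom C k)) \<cdot> ?i)"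
    using assms by simp
  also have "\<dots> = ?i' \<cdot> ((\<alpha> (Cod C f) (Cod C h) (Cod C k) \<cdot> ?F) \<cdot> ?i)"
    using Assoc_natural[OF assms] by simp
  also have "\<dots> = ?F \<cdot> ?i"
    using assms by simp
  finally show ?thesis .
qed

lemma inv_LUnit_natural:
  assumes "f \<in> Ar C"
  shows "(\<one> \<I> \<otimes> f) \<cdot> inv_ar C (\<ell> (Dom C f)) = inv_ar C (\<ell> (Cod C f)) \<cdot> f"
proof -
  have nat: "\<ell> (Cod C f) \<cdot> (\<one> \<I> \<otimes> f) = f \<cdot> \<ell> (Dom C f)"
    by (rule LUnit_nat) (use assms in \<open>auto simp: hom_iff\<close>)
  have "(\<one> \<I> \<otimes> f) \<cdot> inv_ar C (\<ell> (Dom C f))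
        = inv_ar C (\<ell> (Cod C f)) \<cdot> ((\<ell> (Cod C f) \<cdot> (\<one> \<I> \<otimes> f)) \<cdot> inv_ar C (\<ell> (Dom C f)))"
    using assms by simp
  also have "\<dots> = inv_ar C (\<ell> (Cod C f)) \<cdot> f"
    unfolding nat using assms by simp
  finally show ?thesis .
qed

text \<open>By naturality of \<rho>, every arrow \<open>u\<close> is
  \<open>u \<otimes> \<one> \<I>\<close> conjugated by right unitors.\<close>

lemma RUnit_faithful:
  assumes "f \<in> Ar C" "h \<in> Ar C" "Dom C f = Dom C h" "Cod C f = Cod C h"
    and eq: "f \<otimes> \<one> \<I> = h \<otimes> \<one> \<I>"
  shows "f = h"
proof -
  have nat: "u \<cdot> \<rho> (Dom C u) = \<rho> (Cod C u) \<cdot> (u \<otimes> \<one> \<I>)" if "u \<in> Ar C" for u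
    by (rule RUnit_nat[symmetric]) (use that in \<open>auto simp: hom_iff\<close>)
  have "f = (f \<cdot> \<rho> (Dom C f)) \<cdot> inv_ar C (\<rho> (Dom C f))"
    using assms(1) by simp
  also have "\<dots> = (h \<cdot> \<rho> (Dom C h)) \<cdot> inv_ar C (\<rho> (Dom C h))"
    using nat[OF assms(1)] nat[OF assms(2)] assms(3,4) eq by simp
  also have "\<dots> = h"
    using assms(2) by simp
  finally show ?thesis .
qed

text \<open>
  Kelly's redundancy argument: both sides agree after tensoring with \<open>\<one> \<I>\<close>, by the pentagon and
  two triangles, and tensoring with the unit is faithful.
\<close>

lemma RUnit_TensOb:
  assumes [simp]: "A \<in> Ob C" "B \<in> Ob C"
  shows "(\<one> A \<otimes> \<rho> B) \<cdot> \<alpha> A B \<I> = \<rho> (A \<odot> B)"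
proof (rule RUnit_faithful)
  let ?u = "((\<one> A \<otimes> \<rho> B) \<cdot> \<alpha> A B \<I>) \<otimes> \<one> \<I>"
  have nat1: "\<alpha> A B \<I> \<cdot> ((\<one> A \<otimes> \<rho> B) \<otimes> \<one> \<I>) = (\<one> A \<otimes> (\<rho> B \<otimes> \<one> \<I>)) \<cdot> \<alpha> A (B \<odot> \<I>) \<I>"
    using Assoc_natural[of "\<one> A" "\<rho> B" "\<one> \<I>"] by simp
  have nat2: "\<alpha> A B \<I> \<cdot> (\<one> (A \<odot> B) \<otimes> \<ell> \<I>) = (\<one> A \<otimes> (\<one> B \<otimes> \<ell> \<I>)) \<cdot> \<alpha> A B (\<I> \<odot> \<I>)"
    using Assoc_natural[of "\<one> A" "\<one> B" "\<ell> \<I>"] by simp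
  have "\<alpha> A B \<I> \<cdot> ?u = (\<alpha> A B \<I> \<cdot> ((\<one> A \<otimes> \<rho> B) \<otimes> \<one> \<I>)) \<cdot> (\<alpha> A B \<I> \<otimes> \<one> \<I>)"
    by simp
  also have "\<dots> = (\<one> A \<otimes> (\<rho> B \<otimes> \<one> \<I>)) \<cdot> (\<alpha> A (B \<odot> \<I>) \<I> \<cdot> (\<alpha> A B \<I> \<otimes> \<one> \<I>))"
    unfolding nat1 by simp
  \<comment> \<open>The triangle for \<open>B\<close> replaces
    \<open>\<rho> B \<otimes> \<one> \<I>\<close>, and the associator it brings in completes the
    right-hand side of the pentagon.\<close>
  also have "\<dots> = (\<one> A \<otimes> (\<one> B \<otimes> \<ell> \<I>))
      \<cdot> ((\<one> A \<otimes> \<alpha> B \<I> \<I>) \<cdot> \<alpha> A (B \<odot> \<I>) \<I> \<cdot> (\<alpha> A B \<I> \<otimes> \<one> \<I>))"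
    unfolding triangle[OF assms(2) Unit_Ob, symmetric] by simp
  also have "\<dots> = ((\<one> A \<otimes> (\<one> B \<otimes> \<ell> \<I>)) \<cdot> \<alpha> A B (\<I> \<odot> \<I>)) \<cdot> \<alpha> (A \<odot> B) \<I> \<I>"
    unfolding pentagon[OF assms Unit_Ob Unit_Ob, symmetric] by simp
  also have "\<dots> = \<alpha> A B \<I> \<cdot> ((\<one> (A \<odot> B) \<otimes> \<ell> \<I>) \<cdot> \<alpha> (A \<odot> B) \<I> \<I>)"
    unfolding nat2[symmetric] by (simp del: TensAr_Id)
  also have "\<dots> = \<alpha> A B \<I> \<cdot> (\<rho> (A \<odot> B) \<otimes> \<one> \<I>)"
    by (simp add: triangle)
  finally have eq: "\<alpha> A B \<I> \<cdot> ?u = \<alpha> A B \<I> \<cdot> (\<rho> (A \<odot> B) \<otimes> \<one> \<I>)" .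
  have "?u = inv_ar C (\<alpha> A B \<I>) \<cdot> (\<alpha> A B \<I> \<cdot> ?u)"
    by simp
  also have "\<dots> = \<rho> (A \<odot> B) \<otimes> \<one> \<I>"
    unfolding eq by simp
  finally show "?u = \<rho> (A \<odot> B) \<otimes> \<one> \<I>" .
qed auto

lemma Sym_natural:
  assumes "f \<in> Ar C" "h \<in> Ar C"
  shows "\<sigma> (Cod C f) (Cod C h) \<cdot> (f \<otimes> h) = (h \<otimes> f) \<cdot> \<sigma> (Dom C f) (Dom C h)"
  by (rule Sym_nat) (use assms in \<open>auto simp: hom_iff\<close>)

text \<open>The second hexagon follows from the first by passing to inverses, since
  \<open>\<sigma>\<close> is inverted by swapping back.\<close>

lemma hexagon_inv:
  assumes [simp]: "A \<in> Ob C" "B \<in> Ob C" "D \<in> Ob C"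
  shows "\<sigma> (A \<odot> B) D \<cdot> inv_ar C (\<alpha> A B D)
         = \<alpha> D A B \<cdot> (\<sigma> A D \<otimes> \<one> B) \<cdot> inv_ar C (\<alpha> A D B) \<cdot> (\<one> A \<otimes> \<sigma> B D)"
    (is "?L = ?R")
proof -
  let ?H = "\<alpha> A B D \<cdot> \<sigma> D (A \<odot> B)"
  have "\<alpha> A B D \<cdot> \<sigma> D (A \<odot> B)
        = (\<alpha> A B D \<cdot> \<sigma> D (A \<odot> B) \<cdot> \<alpha> D A B) \<cdot> inv_ar C (\<alpha> D A B)"
    by simp
  also have "\<dots> = (\<one> A \<otimes> \<sigma> D B) \<cdot> \<alpha> A D B \<cdot> (\<sigma> D A \<otimes> \<one> B) \<cdot> inv_ar C (\<alpha> D A B)"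
    unfolding hexagon[OF assms(3,1,2)] by simp
  finally have H: "?H = (\<one> A \<otimes> \<sigma> D B) \<cdot> \<alpha> A D B \<cdot> (\<sigma> D A \<otimes> \<one> B) \<cdot> inv_ar C (\<alpha> D A B)" .
  \<comment> \<open>\<open>?H\<close> is a left inverse of \<open>?R\<close> and, below, a right
    inverse of \<open>?L\<close>; hence \<open>?L\<close> and \<open>?R\<close> coincide.\<close>
  have HR: "?H \<cdot> ?R = \<one> (A \<odot> (B \<odot> D))"
    unfolding H by (simp add: Sym_Sym)
  have "?L = ?L \<cdot> (?H \<cdot> ?R)"
    unfolding HR by simp
  also have "\<dots> = (?L \<cdot> ?H) \<cdot> ?R"
    by (intro Comp_Comp[symmetric]) simp_all
  also have "?L \<cdot> ?H = \<one> (D \<odot> (A \<odot> B))"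
    by (simp add: Sym_Sym)
  finally show ?thesis
    by simp
qed

section \<open>Iterated tensor products\<close>

lemma tens_ob_Ob [simp]: "(\<And>s. s < k \<Longrightarrow> A s \<in> Ob C) \<Longrightarrow> tens_ob C A k \<in> Ob C"
  by (induction k) auto

lemma tens_ar_typing:
  assumes "\<And>s. s < k \<Longrightarrow> h s \<in> hom C (A s) (B s)"
  shows "tens_ar C h k \<in> hom C (tens_ob C A k) (tens_ob C B k)"
  using assms by (induction k) (auto simp: hom_iff)

lemma tens_ar_Comp:
  assumes "\<And>s. s < k \<Longrightarrow> h s \<in> hom C (A s) (B s)" "\<And>s. s < k \<Longrightarrow> h' s \<in> hom C (B s) (D s)"
  shows "tens_ar C h' k \<cdot> tens_ar C h k = tens_ar C (\<lambda>s. h' s \<cdot> h s) k"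
  using assms
proof (induction k)
  case (Suc k)
  have "tens_ar C h k \<in> hom C (tens_ob C A k) (tens_ob C B k)"
       "tens_ar C h' k \<in> hom C (tens_ob C B k) (tens_ob C D k)"
    using Suc.prems by (auto intro!: tens_ar_typing)
  with Suc show ?case
    by (simp add: hom_iff)
qed simp

lemma tens_ar_cong: "(\<And>s. s < k \<Longrightarrow> h s = h' s) \<Longrightarrow> tens_ar C h k = tens_ar C h' k"
  by (induction k) auto

end

section \<open>Copying, marginals and conditionals\<close>

context markov_category
begin

lemma Copy_typing [simp]:
  assumes "A \<in> Ob C"
  shows "\<Delta> A \<in> Ar C" "Dom C (\<Delta> A) = A" "Cod C (\<Delta> A) = A \<odot> A"
  using Copy_hom[OF assms] by (auto simp: hom_iff)

lemma Del_typing [simp]: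
  assumes "A \<in> Ob C"
  shows "\<epsilon> A \<in> Ar C" "Dom C (\<epsilon> A) = A" "Cod C (\<epsilon> A) = \<I>"
  using Del_hom[OF assms] by (auto simp: hom_iff)

text \<open>Both sides are arrows into the terminal object.\<close>

lemma Del_natural:
  assumes "f \<in> Ar C"
  shows "\<epsilon> (Cod C f) \<cdot> f = \<epsilon> (Dom C f)"
proof -
  have "\<epsilon> (Cod C f) \<cdot> f \<in> hom C (Dom C f) \<I>" "\<epsilon> (Dom C f) \<in> hom C (Dom C f) \<I>"
    using assms by (auto simp: hom_iff)
  then show ?thesis
    using Unit_terminal[of "Dom C f"] assms by auto
qed

lemma marg_left_typing [simp]:
  assumes "A \<in> Ob C" "B \<in> Ob C"
  shows "marg_left C A B \<in> Ar C" "Dom C (marg_left C A B) = A \<odot> B" "Cod C (marg_left C A B) = A"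
  using assms by (auto simp: marg_left_def)

lemma marg_right_typing [simp]:
  assumes "A \<in> Ob C" "B \<in> Ob C"
  shows "marg_right C A B \<in> Ar C" "Dom C (marg_right C A B) = A \<odot> B" "Cod C (marg_right C A B) = B"
  using assms by (auto simp: marg_right_def)

text \<open>Deleting the output of \<open>v\<close> is deleting its input, and \<open>u\<close>
  slides past the right unitor.\<close>

lemma marg_left_natural:
  assumes "u \<in> Ar C" "v \<in> Ar C"
  shows "marg_left C (Cod C u) (Cod C v) \<cdot> (u \<otimes> v) = u \<cdot> marg_left C (Dom C u) (Dom C v)"
proof -
  have nat: "\<rho> (Cod C u) \<cdot> (u \<otimes> \<one> \<I>) = u \<cdot> \<rho> (Dom C u)"
    by (rule RUnit_nat) (use assms in \<open>auto simp: hom_iff\<close>)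
  have "marg_left C (Cod C u) (Cod C v) \<cdot> (u \<otimes> v) = \<rho> (Cod C u) \<cdot> (u \<otimes> \<epsilon> (Dom C v))"
    using assms by (simp add: marg_left_def Del_natural)
  also have "\<dots> = (\<rho> (Cod C u) \<cdot> (u \<otimes> \<one> \<I>)) \<cdot> (\<one> (Dom C u) \<otimes> \<epsilon> (Dom C v))"
    using assms by simp
  also have "\<dots> = u \<cdot> marg_left C (Dom C u) (Dom C v)"
    unfolding nat using assms by (simp add: marg_left_def)
  finally show ?thesis .
qed

text \<open>Naturality of deletion removes \<open>f\<close>; the counit law then undoes the
  copy.\<close>

lemma marg_left_graph:
  assumes "f \<in> Ar C" "Dom C f = A" "Cod C f = B"
  shows "marg_left C A B \<cdot> ((\<one> A \<otimes> f) \<cdot> \<Delta> A) = \<one> A"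
proof -
  have A: "A \<in> Ob C" "B \<in> Ob C"
    using assms by auto
  have "\<epsilon> B \<cdot> f = \<epsilon> A"
    using Del_natural assms by auto
  then show ?thesis
    using assms A Copy_counit_right[of A] by (simp add: marg_left_def)
qed

lemma marg_right_graph:
  assumes "f \<in> Ar C" "Dom C f = A" "Cod C f = B"
  shows "marg_right C A B \<cdot> ((\<one> A \<otimes> f) \<cdot> \<Delta> A) = f"
proof -
  have A [simp]: "A \<in> Ob C" "B \<in> Ob C"
    using assms by auto
  have nat: "\<ell> B \<cdot> (\<one> \<I> \<otimes> f) = f \<cdot> \<ell> A"
    by (rule LUnit_nat) (use assms in \<open>auto simp: hom_iff\<close>)
  have "marg_right C A B \<cdot> ((\<one> A \<otimes> f) \<cdot> \<Delta> A)
        = (\<ell> B \<cdot> (\<one> \<I> \<otimes> f)) \<cdot> (\<epsilon> A \<otimes> \<one> A) \<cdot> \<Delta> A"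
    using assms by (simp add: marg_right_def)
  also have "\<dots> = f \<cdot> (\<ell> A \<cdot> (\<epsilon> A \<otimes> \<one> A) \<cdot> \<Delta> A)"
    unfolding nat using assms by simp
  also have "\<dots> = f"
    using assms by (simp only: Copy_counit_left A) simp
  finally show ?thesis .
qed

text \<open>Naturality moves the deletion inside the brackets. What remains is the unit coherence
  \<open>RUnit_TensOb\<close>.\<close>

lemma marg_left_inv_Assoc:
  assumes [simp]: "A \<in> Ob C" "B \<in> Ob C" "D \<in> Ob C"
  shows "marg_left C (A \<odot> B) D \<cdot> inv_ar C (\<alpha> A B D) = \<one> A \<otimes> marg_left C B D"
proof -
  have nat: "(\<one> (A \<odot> B) \<otimes> \<epsilon> D) \<cdot> inv_ar C (\<alpha> A B D)
             = inv_ar C (\<alpha> A B \<I>) \<cdot> (\<one> A \<otimes> (\<one> B \<otimes> \<epsilon> D))"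
    using inv_Assoc_natural[of "\<one> A" "\<one> B" "\<epsilon> D"] by simp
  have "marg_left C (A \<odot> B) D \<cdot> inv_ar C (\<alpha> A B D)
        = \<rho> (A \<odot> B) \<cdot> ((\<one> (A \<odot> B) \<otimes> \<epsilon> D) \<cdot> inv_ar C (\<alpha> A B D))"
    by (simp add: marg_left_def)
  also have "\<dots> = \<one> A \<otimes> marg_left C B D"
    unfolding nat RUnit_TensOb[of A B, symmetric, simplified] by (simp add: marg_left_def)
  finally show ?thesis .
qed

text \<open>
  After coassociativity the two sides differ only in how they reorder the factors
  \<open>W, W, Y, Y\<close>; by the hexagon the discrepancy is a swap of the two copies of \<open>Y\<close>, which
  cocommutativity absorbs.
\<close>

lemma conditional_copy_input:
  assumes c: "is_conditional C W X Y r c"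
    and [simp]: "W \<in> Ob C" "X \<in> Ob C" "Y \<in> Ob C"
    and r: "r \<in> hom C W (X \<odot> Y)"
  shows "(\<one> (W \<odot> Y) \<otimes> c) \<cdot> \<Delta> (W \<odot> Y) \<cdot> (\<one> W \<otimes> (marg_right C X Y \<cdot> r)) \<cdot> \<Delta> W
         = inv_ar C (\<alpha> W Y X) \<cdot> (\<one> W \<otimes> (\<sigma> X Y \<cdot> r)) \<cdot> \<Delta> W"
proof -
  define k where "k = marg_right C X Y \<cdot> r"
  have [simp]: "k \<in> Ar C" "Dom C k = W" "Cod C k = Y"
    using r by (auto simp: k_def hom_iff)
  have [simp]: "c \<in> Ar C" "Dom C c = W \<odot> Y" "Cod C c = X"
    using c by (auto simp: is_conditional_def hom_iff)
  let ?ai = "inv_ar C (\<alpha> W Y Y)"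
  let ?sw = "\<alpha> Y W Y \<cdot> (\<sigma> W Y \<otimes> \<one> Y) \<cdot> ?ai"
  let ?w = "(\<one> W \<otimes> (\<Delta> Y \<cdot> k)) \<cdot> \<Delta> W"
  have r_eq: "r = (c \<otimes> \<one> Y) \<cdot> ?ai \<cdot> ?w"
    using c by (simp add: is_conditional_def k_def)
  have swc: "\<sigma> X Y \<cdot> (c \<otimes> \<one> Y) = (\<one> Y \<otimes> c) \<cdot> \<sigma> (W \<odot> Y) Y"
    using Sym_natural[of c "\<one> Y"] by simp
  have "\<sigma> X Y \<cdot> r = (\<sigma> X Y \<cdot> (c \<otimes> \<one> Y)) \<cdot> ?ai \<cdot> ?w"
    unfolding r_eq by simp
  also have "\<dots> = (\<one> Y \<otimes> c) \<cdot> (\<sigma> (W \<odot> Y) Y \<cdot> ?ai) \<cdot> ?w"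
    unfolding swc by simp
  also have "\<dots> = (\<one> Y \<otimes> c) \<cdot> ?sw \<cdot> (\<one> W \<otimes> ((\<sigma> Y Y \<cdot> \<Delta> Y) \<cdot> k)) \<cdot> \<Delta> W"
    unfolding hexagon_inv[of W Y Y, simplified] by simp
  also have "\<dots> = (\<one> Y \<otimes> c) \<cdot> ?sw \<cdot> ?w"
    by (simp only: Copy_commute \<open>Y \<in> Ob C\<close>)
  finally have sr: "\<sigma> X Y \<cdot> r = (\<one> Y \<otimes> c) \<cdot> ?sw \<cdot> ?w" .
  have nat1: "inv_ar C (\<alpha> W Y X) \<cdot> (\<one> W \<otimes> (\<one> Y \<otimes> c))
              = (\<one> (W \<odot> Y) \<otimes> c) \<cdot> inv_ar C (\<alpha> W Y (W \<odot> Y))"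
    using inv_Assoc_natural[of "\<one> W" "\<one> Y" c] by simp
  have nat2: "(\<one> W \<otimes> (\<one> W \<otimes> (\<Delta> Y \<cdot> k))) \<cdot> \<alpha> W W W
              = \<alpha> W W (Y \<odot> Y) \<cdot> (\<one> (W \<odot> W) \<otimes> (\<Delta> Y \<cdot> k))"
    using Assoc_natural[of "\<one> W" "\<one> W" "\<Delta> Y \<cdot> k"] by simp
  \<comment> \<open>Inside \<open>?w\<close> the second copy of \<open>W\<close> is copied again;
    coassociativity moves this duplication to the first copy.\<close>
  have "(\<one> W \<otimes> ?w) \<cdot> \<Delta> W = (\<one> W \<otimes> (\<one> W \<otimes> (\<Delta> Y \<cdot> k))) \<cdot> ((\<one> W \<otimes> \<Delta> W) \<cdot> \<Delta> W)"
    by simp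
  also have "\<dots> = ((\<one> W \<otimes> (\<one> W \<otimes> (\<Delta> Y \<cdot> k))) \<cdot> \<alpha> W W W) \<cdot> (\<Delta> W \<otimes> \<one> W) \<cdot> \<Delta> W"
    by (simp del: interchange interchange_Comp flip: Copy_coassoc)
  also have "\<dots> = \<alpha> W W (Y \<odot> Y) \<cdot> (\<Delta> W \<otimes> (\<Delta> Y \<cdot> k)) \<cdot> \<Delta> W"
    unfolding nat2 by simp
  finally have ww: "(\<one> W \<otimes> ?w) \<cdot> \<Delta> W = \<alpha> W W (Y \<odot> Y) \<cdot> (\<Delta> W \<otimes> (\<Delta> Y \<cdot> k)) \<cdot> \<Delta> W" .
  have "inv_ar C (\<alpha> W Y X) \<cdot> (\<one> W \<otimes> (\<sigma> X Y \<cdot> r)) \<cdot> \<Delta> W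
        = (inv_ar C (\<alpha> W Y X) \<cdot> (\<one> W \<otimes> (\<one> Y \<otimes> c))) \<cdot> (\<one> W \<otimes> ?sw) \<cdot> ((\<one> W \<otimes> ?w) \<cdot> \<Delta> W)"
    unfolding sr by simp
  \<comment> \<open>The bracketed block is exactly \<open>middle_swap C W W Y Y\<close>, so
    \<open>Copy_tensor\<close> assembles it with the two copies into
    \<open>\<Delta> (W \<odot> Y)\<close>.\<close>
  also have "\<dots> = (\<one> (W \<odot> Y) \<otimes> c) \<cdot> (inv_ar C (\<alpha> W Y (W \<odot> Y))
      \<cdot> (\<one> W \<otimes> ?sw) \<cdot> \<alpha> W W (Y \<odot> Y)) \<cdot> (\<Delta> W \<otimes> \<Delta> Y) \<cdot> (\<one> W \<otimes> k) \<cdot> \<Delta> W"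
    unfolding nat1 ww by simp
  also have "\<dots> = (\<one> (W \<odot> Y) \<otimes> c) \<cdot> \<Delta> (W \<odot> Y) \<cdot> (\<one> W \<otimes> k) \<cdot> \<Delta> W"
    by (simp add: Copy_tensor middle_swap_def)
  finally show ?thesis
    by (simp add: k_def)
qed

end

section \<open>Marginals of a hidden Markov model\<close>

locale hidden_markov_model = markov_category C
  for C :: "('o, 'm, 'x) markov_data_scheme" (structure) +
  fixes n :: nat and X Y :: "nat \<Rightarrow> 'o" and f g :: "nat \<Rightarrow> 'm"
  assumes kernels: "hmm_kernels C n X Y f g"
begin

lemma X_Y_Ob [simp]: "t \<le> n \<Longrightarrow> X t \<in> Ob C" "t \<le> n \<Longrightarrow> Y t \<in> Ob C"
  using kernels by (auto simp: hmm_kernels_def)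

lemma f_typing [simp]:
  assumes "t \<le> n"
  shows "f t \<in> Ar C" "Dom C (f t) = pred_ob C X t" "Cod C (f t) = X t"
  using kernels assms by (auto simp: hmm_kernels_def hom_iff)

lemma g_typing [simp]:
  assumes "t \<le> n"
  shows "g t \<in> Ar C" "Dom C (g t) = X t" "Cod C (g t) = Y t"
  using kernels assms by (auto simp: hmm_kernels_def hom_iff)

lemma pred_ob_simps [simp]: "pred_ob C X 0 = \<I>" "pred_ob C X (Suc t) = X t"
  by (auto simp: pred_ob_def)

lemma hidden_chain_hom: "t \<le> n \<Longrightarrow> hidden_chain C X f t \<in> hom C \<I> (tens_ob C X (Suc t))"
  by (induction t) (auto simp: hom_iff)

lemma hidden_chain_typing [simp]:
  assumes "t \<le> n"
  shows "hidden_chain C X f t \<in> Ar C" "Dom C (hidden_chain C X f t) = \<I>"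
    "Cod C (hidden_chain C X f t) = tens_ob C X t \<odot> X t"
  using hidden_chain_hom[OF assms] by (auto simp: hom_iff)

abbreviation emission :: "nat \<Rightarrow> 'm" where
  "emission t \<equiv> (\<one> (X t) \<otimes> g t) \<cdot> \<Delta> (X t)"

text \<open>The index counts factors, so \<open>obs_past t\<close> concerns the times strictly
  before \<open>t\<close>.\<close>

abbreviation obs_past :: "nat \<Rightarrow> 'm" where
  "obs_past k \<equiv> tens_ar C g k"

lemma obs_past_typing [simp]:
  assumes "k \<le> Suc n"
  shows "obs_past k \<in> Ar C" "Dom C (obs_past k) = tens_ob C X k" "Cod C (obs_past k) = tens_ob C Y k"
  using tens_ar_typing[of k g X Y] assms by (auto simp: hom_iff)

lemma emissions_typing [simp]:
  assumes "k \<le> Suc n"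
  shows "tens_ar C emission k \<in> Ar C" "Dom C (tens_ar C emission k) = tens_ob C X k"
    "Cod C (tens_ar C emission k) = tens_ob C (\<lambda>s. X s \<odot> Y s) k"
  using tens_ar_typing[of k emission X "\<lambda>s. X s \<odot> Y s"] assms by (auto simp: hom_iff)

text \<open>Both tensors act factor by factor, so \<open>marg_right_graph\<close> applies at each
  time.\<close>

lemma marg_right_emissions:
  assumes "k \<le> Suc n"
  shows "tens_ar C (\<lambda>s. marg_right C (X s) (Y s)) k \<cdot> tens_ar C emission k = obs_past k"
proof -
  have "tens_ar C (\<lambda>s. marg_right C (X s) (Y s)) k \<cdot> tens_ar C emission k
        = tens_ar C (\<lambda>s. marg_right C (X s) (Y s) \<cdot> emission s) k"
    by (rule tens_ar_Comp[where A = X and B = "\<lambda>s. X s \<odot> Y s" and D = Y])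
       (use assms in \<open>auto simp: hom_iff\<close>)
  also have "\<dots> = obs_past k"
    by (rule tens_ar_cong, rule marg_right_graph) (use assms in auto)
  finally show ?thesis .
qed

section \<open>Discarding the future of the model\<close>

lemma hmm_typing [simp]:
  assumes "t \<le> n"
  shows "hmm C t X f g \<in> Ar C" "Dom C (hmm C t X f g) = \<I>"
    "Cod C (hmm C t X f g) = tens_ob C (\<lambda>s. X s \<odot> Y s) t \<odot> (X t \<odot> Y t)"
  using assms unfolding hmm_def by auto

text \<open>Past the associator, the deletion meets only the last transition, whose graph has the
  identity as its first marginal.\<close>

lemma marg_left_hidden_chain:
  assumes "Suc t \<le> n"
  shows "marg_left C (tens_ob C X (Suc t)) (X (Suc t)) \<cdot> hidden_chain C X f (Suc t) = hidden_chain C X f t"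
proof -
  let ?T = "tens_ob C X t"
  let ?e = "(\<one> (X t) \<otimes> f (Suc t)) \<cdot> \<Delta> (X t)"
  have [simp]: "?T \<in> Ob C"
    using assms by simp
  have "marg_left C (?T \<odot> X t) (X (Suc t)) \<cdot> hidden_chain C X f (Suc t)
        = (marg_left C (?T \<odot> X t) (X (Suc t)) \<cdot> inv_ar C (\<alpha> ?T (X t) (X (Suc t))))
          \<cdot> (\<one> ?T \<otimes> ?e) \<cdot> hidden_chain C X f t"
    using assms by simp
  also have "\<dots> = (\<one> ?T \<otimes> (marg_left C (X t) (X (Suc t)) \<cdot> ?e)) \<cdot> hidden_chain C X f t"
    using assms by (subst marg_left_inv_Assoc) auto
  also have "\<dots> = hidden_chain C X f t"
    using assms by (subst marg_left_graph) auto
  finally show ?thesis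
    by simp
qed

text \<open>The deletion slides through the emissions, removes the last one, and reaches the hidden
  chain.\<close>

lemma marg_left_hmm:
  assumes "Suc t \<le> n"
  shows "marg_left C (tens_ob C (\<lambda>s. X s \<odot> Y s) (Suc t)) (X (Suc t) \<odot> Y (Suc t))
           \<cdot> hmm C (Suc t) X f g = hmm C t X f g"
proof -
  let ?E = "tens_ar C emission (Suc t)"
  have nat: "marg_left C (tens_ob C (\<lambda>s. X s \<odot> Y s) (Suc t)) (X (Suc t) \<odot> Y (Suc t))
               \<cdot> (?E \<otimes> emission (Suc t))
             = ?E \<cdot> marg_left C (tens_ob C X (Suc t)) (X (Suc t))"
    using marg_left_natural[of ?E "emission (Suc t)"] assms by simp
  have "marg_left C (tens_ob C (\<lambda>s. X s \<odot> Y s) (Suc t)) (X (Suc t) \<odot> Y (Suc t)) \<cdot> hmm C (Suc t) X f g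
        = (marg_left C (tens_ob C (\<lambda>s. X s \<odot> Y s) (Suc t)) (X (Suc t) \<odot> Y (Suc t))
            \<cdot> (?E \<otimes> emission (Suc t))) \<cdot> hidden_chain C X f (Suc t)"
    using assms unfolding hmm_def by (simp del: hidden_chain.simps)
  also have "\<dots> = ?E \<cdot> (marg_left C (tens_ob C X (Suc t)) (X (Suc t)) \<cdot> hidden_chain C X f (Suc t))"
    unfolding nat using assms by (simp del: hidden_chain.simps)
  also have "\<dots> = hmm C t X f g"
    unfolding marg_left_hidden_chain[OF assms] hmm_def ..
  finally show ?thesis .
qed

lemma del_tail_typing:
  assumes "j \<le> k" "k \<le> Suc n"
  shows "del_tail C (\<lambda>s. X s \<odot> Y s) j k
         \<in> hom C (tens_ob C (\<lambda>s. X s \<odot> Y s) k) (tens_ob C (\<lambda>s. X s \<odot> Y s) j)"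
  using assms
proof (induction k)
  case (Suc k)
  then show ?case
    by (cases "j = Suc k") (auto simp: hom_iff)
qed (auto simp: hom_iff)

text \<open>Marginals up to time \<open>t\<close> can thus be computed in the model with horizon
  \<open>t\<close>. The induction is on the horizon because \<open>del_tail\<close> removes the last
  factor first.\<close>

lemma del_tail_hmm:
  assumes "t \<le> k" "k \<le> n"
  shows "del_tail C (\<lambda>s. X s \<odot> Y s) (Suc t) (Suc k) \<cdot> hmm C k X f g = hmm C t X f g"
  using assms
proof (induction k)
  case (Suc k)
  \<comment> \<open>If \<open>t = Suc k\<close>, nothing lies beyond \<open>t\<close> and
    \<open>del_tail\<close> is an identity.\<close>
  show ?case
  proof (cases "t = Suc k")
    case False
    let ?d = "del_tail C (\<lambda>s. X s \<odot> Y s) (Suc t) (Suc k)"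
    let ?m = "marg_left C (tens_ob C (\<lambda>s. X s \<odot> Y s) (Suc k)) (X (Suc k) \<odot> Y (Suc k))"
    have "t \<le> k"
      using False Suc.prems by simp
    have d: "?d \<in> hom C (tens_ob C (\<lambda>s. X s \<odot> Y s) (Suc k)) (tens_ob C (\<lambda>s. X s \<odot> Y s) (Suc t))"
      using \<open>t \<le> k\<close> Suc.prems by (intro del_tail_typing) auto
    have "del_tail C (\<lambda>s. X s \<odot> Y s) (Suc t) (Suc (Suc k)) \<cdot> hmm C (Suc k) X f g
          = (?d \<cdot> ?m) \<cdot> hmm C (Suc k) X f g"
      using \<open>t \<le> k\<close> by simp
    also have "\<dots> = ?d \<cdot> (?m \<cdot> hmm C (Suc k) X f g)"
      using d Suc.prems by (intro Comp_Comp) (auto simp: hom_iff)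
    also have "\<dots> = hmm C t X f g"
      using marg_left_hmm Suc.IH \<open>t \<le> k\<close> Suc.prems by simp
    finally show ?thesis .
  qed (use Suc.prems in simp)
qed simp

section \<open>Closed forms of the marginals\<close>

abbreviation obs_state :: "nat \<Rightarrow> 'm" where
  "obs_state t \<equiv> marg_obs C n X Y t (hmm C n X f g)"

lemma obs_state_eq:
  assumes "t \<le> n"
  shows "obs_state t = (obs_past t \<otimes> g t) \<cdot> hidden_chain C X f t"
proof -
  let ?M = "tens_ar C (\<lambda>s. marg_right C (X s) (Y s)) (Suc t)"
  have M: "?M \<in> hom C (tens_ob C (\<lambda>s. X s \<odot> Y s) (Suc t)) (tens_ob C Y (Suc t))"
    by (rule tens_ar_typing) (use assms in \<open>auto simp: hom_iff\<close>)
  have "obs_state t = ?M \<cdot> hmm C t X f g"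
    using del_tail_hmm[OF assms order_refl] by (simp add: marg_obs_def)
  also have "\<dots> = (?M \<cdot> tens_ar C emission (Suc t)) \<cdot> hidden_chain C X f t"
    using M assms emissions_typing[of "Suc t"] unfolding hmm_def
    by (intro Comp_Comp[symmetric]) (auto simp: hom_iff)
  also have "\<dots> = (obs_past t \<otimes> g t) \<cdot> hidden_chain C X f t"
    using marg_right_emissions[of "Suc t"] assms by simp
  finally show ?thesis .
qed

lemma obs_state_typing [simp]:
  assumes "t \<le> n"
  shows "obs_state t \<in> Ar C" "Dom C (obs_state t) = \<I>" "Cod C (obs_state t) = tens_ob C Y t \<odot> Y t"
  using assms by (auto simp: obs_state_eq)

text \<open>This is \<open>s\<^sub>t\<close> of the outline: past hidden states are replaced by
  their observations, while the one at time \<open>t\<close> is left untouched.\<close>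

definition predicted :: "nat \<Rightarrow> 'm" where
  "predicted t = (obs_past t \<otimes> \<one> (X t)) \<cdot> hidden_chain C X f t"

lemma predicted_typing [simp]:
  assumes "t \<le> n"
  shows "predicted t \<in> Ar C" "Dom C (predicted t) = \<I>" "Cod C (predicted t) = tens_ob C Y t \<odot> X t"
  using assms by (auto simp: predicted_def)

lemma obs_state_predicted:
  "t \<le> n \<Longrightarrow> obs_state t = (\<one> (tens_ob C Y t) \<otimes> g t) \<cdot> predicted t"
  by (simp add: obs_state_eq predicted_def)

text \<open>On the past factors only the observations survive. At time \<open>t\<close> the whole
  emission is kept and swapped, so that \<open>Y t\<close> can be bracketed with the past.\<close>

lemma marg_obs_hidden_predicted:
  assumes "t \<le> n"
  shows "marg_obs_hidden C n X Y t (hmm C n X f g)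
         = inv_ar C (\<alpha> (tens_ob C Y t) (Y t) (X t))
           \<cdot> (\<one> (tens_ob C Y t) \<otimes> (\<sigma> (X t) (Y t) \<cdot> emission t)) \<cdot> predicted t"
proof -
  let ?M = "tens_ar C (\<lambda>s. marg_right C (X s) (Y s)) t"
  have M: "?M \<in> hom C (tens_ob C (\<lambda>s. X s \<odot> Y s) t) (tens_ob C Y t)"
    by (rule tens_ar_typing) (use assms in \<open>auto simp: hom_iff\<close>)
  have "(?M \<otimes> \<sigma> (X t) (Y t)) \<cdot> hmm C t X f g
        = ((?M \<cdot> tens_ar C emission t) \<otimes> (\<sigma> (X t) (Y t) \<cdot> emission t)) \<cdot> hidden_chain C X f t"
    using M assms by (simp add: hmm_def hom_iff)
  also have "\<dots> = (\<one> (tens_ob C Y t) \<otimes> (\<sigma> (X t) (Y t) \<cdot> emission t)) \<cdot> predicted t"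
    using marg_right_emissions[of t] assms by (simp add: predicted_def)
  finally show ?thesis
    using del_tail_hmm[OF assms order_refl] by (simp add: marg_obs_hidden_def)
qed

text \<open>On both sides \<open>X t\<close> is copied once: one copy is observed through
  \<open>g t\<close>, the other is moved on by \<open>f (Suc t)\<close>.\<close>

lemma predicted_Suc:
  assumes "Suc t \<le> n"
  shows "predicted (Suc t)
         = (\<one> (tens_ob C Y (Suc t)) \<otimes> f (Suc t)) \<cdot> marg_obs_hidden C n X Y t (hmm C n X f g)"
proof -
  let ?W = "tens_ob C Y t" and ?T = "tens_ob C X t"
  have [simp]: "?W \<in> Ob C" "?T \<in> Ob C"
    using assms by auto
  have nat1: "((obs_past t \<otimes> g t) \<otimes> \<one> (X (Suc t))) \<cdot> inv_ar C (\<alpha> ?T (X t) (X (Suc t)))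
      = inv_ar C (\<alpha> ?W (Y t) (X (Suc t))) \<cdot> (obs_past t \<otimes> (g t \<otimes> \<one> (X (Suc t))))"
    using inv_Assoc_natural[of "obs_past t" "g t" "\<one> (X (Suc t))"] assms by simp
  have nat2: "(\<one> (?W \<odot> Y t) \<otimes> f (Suc t)) \<cdot> inv_ar C (\<alpha> ?W (Y t) (X t))
      = inv_ar C (\<alpha> ?W (Y t) (X (Suc t))) \<cdot> (\<one> ?W \<otimes> (\<one> (Y t) \<otimes> f (Suc t)))"
    using inv_Assoc_natural[of "\<one> ?W" "\<one> (Y t)" "f (Suc t)"] assms by simp
  \<comment> \<open>Naturality brings the swap next to the copy, where cocommutativity absorbs
    it.\<close>
  have "\<sigma> (X t) (Y t) \<cdot> emission t = (\<sigma> (X t) (Y t) \<cdot> (\<one> (X t) \<otimes> g t)) \<cdot> \<Delta> (X t)"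
    using assms by simp
  also have "\<dots> = ((g t \<otimes> \<one> (X t)) \<cdot> \<sigma> (X t) (X t)) \<cdot> \<Delta> (X t)"
    using Sym_natural[of "\<one> (X t)" "g t"] assms by simp
  also have "\<dots> = (g t \<otimes> \<one> (X t)) \<cdot> \<Delta> (X t)"
    using assms Copy_commute[of "X t"] by simp
  finally have swap: "\<sigma> (X t) (Y t) \<cdot> emission t = (g t \<otimes> \<one> (X t)) \<cdot> \<Delta> (X t)" .
  have "predicted (Suc t)
      = (((obs_past t \<otimes> g t) \<otimes> \<one> (X (Suc t))) \<cdot> inv_ar C (\<alpha> ?T (X t) (X (Suc t))))
        \<cdot> (\<one> ?T \<otimes> ((\<one> (X t) \<otimes> f (Suc t)) \<cdot> \<Delta> (X t))) \<cdot> hidden_chain C X f t"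
    using assms by (simp add: predicted_def)
  also have "\<dots> = inv_ar C (\<alpha> ?W (Y t) (X (Suc t)))
        \<cdot> (obs_past t \<otimes> ((g t \<otimes> f (Suc t)) \<cdot> \<Delta> (X t))) \<cdot> hidden_chain C X f t"
    unfolding nat1 using assms by simp
  \<comment> \<open>\<open>g t \<otimes> f (Suc t)\<close> is split into observing first and moving
    on afterwards.\<close>
  also have "\<dots> = ((\<one> (?W \<odot> Y t) \<otimes> f (Suc t)) \<cdot> inv_ar C (\<alpha> ?W (Y t) (X t)))
        \<cdot> (\<one> ?W \<otimes> ((g t \<otimes> \<one> (X t)) \<cdot> \<Delta> (X t))) \<cdot> predicted t"
    unfolding nat2 using assms by (simp add: predicted_def)
  also have "\<dots> = (\<one> (?W \<odot> Y t) \<otimes> f (Suc t)) \<cdot> marg_obs_hidden C n X Y t (hmm C n X f g)"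
    unfolding marg_obs_hidden_predicted[OF Suc_leD[OF assms]] swap using assms by simp
  finally show ?thesis
    by simp
qed

section \<open>The filter recursion\<close>

definition pred_obs_state :: "nat \<Rightarrow> 'm" where
  "pred_obs_state t = (case t of 0 \<Rightarrow> \<one> \<I> | Suc s \<Rightarrow> obs_state s)"

lemma pred_obs_state_typing [simp]:
  assumes "t \<le> n"
  shows "pred_obs_state t \<in> Ar C" "Dom C (pred_obs_state t) = \<I>"
    "Cod C (pred_obs_state t) = tens_ob C Y t"
  using assms by (cases t; simp add: pred_obs_state_def)+

lemma pred_filter_typing:
  assumes "\<And>s. s < t \<Longrightarrow> is_bayes_filter C n X Y f g s (BF s)"
  shows "pred_filter C BF t \<in> hom C (tens_ob C Y t) (pred_ob C X t)"
proof (cases t)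
  case (Suc s)
  then show ?thesis
    using assms[of s] by (simp add: pred_filter_def is_bayes_filter_def)
qed (simp add: pred_filter_def hom_iff)

lemma predicted_filter:
  assumes BF: "\<And>s. s < t \<Longrightarrow> is_bayes_filter C n X Y f g s (BF s)" and t: "t \<le> n"
  shows "predicted t
         = (\<one> (tens_ob C Y t) \<otimes> (f t \<cdot> pred_filter C BF t)) \<cdot> \<Delta> (tens_ob C Y t) \<cdot> pred_obs_state t"
proof (cases t)
  case 0
  \<comment> \<open>At time 0, \<open>\<Delta> \<I>\<close> is the inverse left unitor; naturality
    moves \<open>f 0\<close> across it, matching the base case of
    \<open>hidden_chain\<close>.\<close>
  then show ?thesis
    using inv_LUnit_natural[of "f 0"]
    by (simp add: predicted_def pred_filter_def pred_obs_state_def Copy_Unit)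
next
  case (Suc s)
  then have "BF s \<in> Ar C" "Dom C (BF s) = tens_ob C Y s \<odot> Y s" "Cod C (BF s) = X s"
    and "marg_obs_hidden C n X Y s (hmm C n X f g)
         = (\<one> (tens_ob C Y t) \<otimes> BF s) \<cdot> \<Delta> (tens_ob C Y t) \<cdot> obs_state s"
    using BF[of s] by (auto simp: is_bayes_filter_def hom_iff)
  then show ?thesis
    using t predicted_Suc[of s] Suc by (simp add: pred_filter_def pred_obs_state_def)
qed

text \<open>Copying \<open>obs_state t\<close> and applying either \<open>BF t\<close> or
  \<open>c\<close> yields the same joint state, namely the marginal on the observations up to
  \<open>t\<close> and \<open>X t\<close>.\<close>

theorem filter_recursion:
  assumes BF: "\<And>s. s \<le> t \<Longrightarrow> is_bayes_filter C n X Y f g s (BF s)" and t: "t \<le> n"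
    and r: "r = (\<one> (X t) \<otimes> g t) \<cdot> \<Delta> (X t) \<cdot> f t \<cdot> pred_filter C BF t"
    and c: "is_conditional C (tens_ob C Y t) (X t) (Y t) r c"
  shows "as_equal C (obs_state t) (BF t) c"
proof -
  define W where "W = tens_ob C Y t"
  \<comment> \<open>\<open>b\<close> predicts \<open>X t\<close> from the past observations, so
    \<open>r\<close> is the emission after \<open>b\<close>.\<close>
  define b where "b = f t \<cdot> pred_filter C BF t"
  let ?P = "pred_obs_state t" and ?k = "marg_right C (X t) (Y t) \<cdot> r"
  have [simp]: "W \<in> Ob C" "X t \<in> Ob C" "Y t \<in> Ob C" "?P \<in> Ar C" "Dom C ?P = \<I>" "Cod C ?P = W"
    "g t \<in> Ar C" "Dom C (g t) = X t" "Cod C (g t) = Y t"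
    using t by (auto simp: W_def)
  have [simp]: "b \<in> Ar C" "Dom C b = W" "Cod C b = X t"
    using pred_filter_typing[of t BF] BF t by (auto simp: b_def hom_iff W_def)
  have r_b: "r = emission t \<cdot> b"
    using pred_filter_typing[of t BF] BF t unfolding r b_def by (simp add: hom_iff)
  then have r_hom: "r \<in> hom C W (X t \<odot> Y t)"
    by (simp add: hom_iff)
  have c_hom: "c \<in> hom C (W \<odot> Y t) (X t)"
    using c by (simp add: is_conditional_def W_def)
  have "?k = (marg_right C (X t) (Y t) \<cdot> emission t) \<cdot> b"
    unfolding r_b by simp
  also have "\<dots> = g t \<cdot> b"
    by (subst marg_right_graph) auto
  finally have k: "?k = g t \<cdot> b" .
  have pred: "predicted t = (\<one> W \<otimes> b) \<cdot> \<Delta> W \<cdot> ?P"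
    unfolding W_def b_def by (rule predicted_filter) (use BF t in auto)
  \<comment> \<open>The new observation is generated through the marginal of \<open>r\<close>, the
    form in which \<open>conditional_copy_input\<close> applies.\<close>
  have obs: "obs_state t = (\<one> W \<otimes> ?k) \<cdot> \<Delta> W \<cdot> ?P"
    using t unfolding k by (simp add: obs_state_predicted pred flip: W_def)
  have "(\<one> (W \<odot> Y t) \<otimes> BF t) \<cdot> \<Delta> (W \<odot> Y t) \<cdot> obs_state t
        = marg_obs_hidden C n X Y t (hmm C n X f g)"
    using BF[of t] by (simp add: is_bayes_filter_def W_def)
  also have "\<dots> = inv_ar C (\<alpha> W (Y t) (X t)) \<cdot> (\<one> W \<otimes> (\<sigma> (X t) (Y t) \<cdot> emission t)) \<cdot> predicted t"
    unfolding marg_obs_hidden_predicted[OF t] W_def ..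
  also have "\<dots> = (inv_ar C (\<alpha> W (Y t) (X t)) \<cdot> (\<one> W \<otimes> (\<sigma> (X t) (Y t) \<cdot> r)) \<cdot> \<Delta> W) \<cdot> ?P"
    unfolding pred r_b by simp
  \<comment> \<open>\<open>conditional_copy_input\<close> is used from right to left, precomposed
    with the state \<open>?P\<close>.\<close>
  also have "\<dots> = ((\<one> (W \<odot> Y t) \<otimes> c) \<cdot> \<Delta> (W \<odot> Y t) \<cdot> (\<one> W \<otimes> ?k) \<cdot> \<Delta> W) \<cdot> ?P"
    using conditional_copy_input[OF c, folded W_def] r_hom by simp
  also have "\<dots> = (\<one> (W \<odot> Y t) \<otimes> c) \<cdot> \<Delta> (W \<odot> Y t) \<cdot> obs_state t"
    unfolding obs k using c_hom by (simp add: hom_iff)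
  finally show ?thesis
    using t by (simp add: as_equal_def W_def)
qed

end

theorem proposition4p2:
  fixes C :: "('o, 'm, 'x) markov_data_scheme" (structure)
    and n t :: nat
    and X Y :: "nat \<Rightarrow> 'o"
    and f g BF :: "nat \<Rightarrow> 'm"
    and r c :: 'm
  assumes "markov_category C"
    and "has_conditionals C"
    and "hmm_kernels C n X Y f g"
    and "\<And>s. s \<le> n \<Longrightarrow> is_bayes_filter C n X Y f g s (BF s)"
    and "t \<le> n"
    and "r = (\<one> (X t) \<otimes> g t) \<cdot> \<Delta> (X t) \<cdot> f t \<cdot> pred_filter C BF t"
    and "is_conditional C (tens_ob C Y t) (X t) (Y t) r c"
  shows "as_equal C (marg_obs C n X Y t (hmm C n X f g)) (BF t) c"
proof -
  interpret hidden_markov_model C n X Y f g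
    using assms(1,3) by (simp add: hidden_markov_model_def hidden_markov_model_axioms_def)
  show ?thesis
    using assms by (intro filter_recursion) auto
qed

end
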